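(* Let $k\geq2$ and let $\mathcal{C}$ be a $k$-overlap closed hereditary class of $\mathcal{L}$-structures. Let $\mathcal{C}'$ be a hereditary class of $\mathcal{L}'$-structures, where $\mathcal{L}'$ consists of relation symbols of arity at most $k$. Then every consistent random $\mathcal{C}'$-expansion of $\mathcal{C}$ is exchangeable.
   Context: $\mathcal{L},\mathcal{L}'$ are disjoint relational languages; relations never hold on tuples with repeated entries. A hereditary class is a class of structures with domains finite subsets of $\mathbb{N}$, closed under isomorphism and substructures; $\mathcal{D}[n]$ denotes members with domain $[n]$. $A*B$ denotes the superposition of an $\mathcal{L}$-structure $A$ and an $\mathcal{L}'$-structure $B$ on the same domain. $k$-overlap closed: all arities of $\mathcal{C}$ exceed $k$, and for every $r>k$ there are constants $C(r),\alpha(r)>0$ such that for arbitrarily large $n$ there is an $r$-uniform hypergraph $\mathbb{K}$ on $n$ vertices with at least $C(r)n^{k+\alpha(r)}$ hyperedges, no two hyperedges meeting in more than $k$ vertices, and such that for all $H_1,H_2\in\mathcal{C}[r]$ and every $\mathcal{L}$-structure $G_0$ on the vertices of $\mathbb{K}$ whose induced substructure on each hyperedge is isomorphic to $H_1$ or $H_2$, there is an injective homomorphism of $G_0$ into some $G\in\mathcal{C}$ with $n$ elements restricting to an embedding on each hyperedge. A consistent random $\mathcal{C}'$-expansion of $\mathcal{C}$ assigns to each $A\in\mathcal{C}$ a probability distribution $\mathbb{P}_A$ on $\mathcal{L}'$-structures on the domain of $A$, concentrated on $\mathcal{C}'$, such that for every embedding $\phi:\mathbf{H}\to\mathbf{G}$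 in $\mathcal{C}$ and every $\mathcal{L}'$-structure $\mathbf{H}'$ on $H$, $\mathbb{P}_{\mathbf{H}}(\mathbf{H}')$ equals the $\mathbb{P}_{\mathbf{G}}$-probability that the random structure restricted to $\phi(H)$ and pulled back by $\phi$ equals $\mathbf{H}'$; $\mathbb{P}_A(A*A'):=\mathbb{P}_A(A')$. It is exchangeable if $\mathbb{P}_{\mathbf{H}_1}(\mathbf{H}_1*\mathbf{H}')=\mathbb{P}_{\mathbf{H}_2}(\mathbf{H}_2*\mathbf{H}')$ for all $r$, $\mathbf{H}_1,\mathbf{H}_2\in\mathcal{C}[r]$ and $\mathcal{L}'$-structures $\mathbf{H}'$ on $[r]$. *)

theory Defs
  imports "HOL-Probability.Probability"
begin

text \<open>
  A relational language is a set \<open>L\<close> of symbols of type \<open>'s\<close>, with arities given by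
  \<open>ar :: 's \<Rightarrow> nat\<close>. The same symbol type serves all languages, so that two languages can be
  required to be disjoint.
\<close>

record 's rstruct =
  Dom :: "nat set"
  Rel :: "'s \<Rightarrow> nat list set"

text \<open>
  Symbols outside \<open>L\<close> are interpreted by the empty relation, so that
  equality of records is equality of \<open>L\<close>-structures.
\<close>

definition structures_on :: "('s \<Rightarrow> nat) \<Rightarrow> 's set \<Rightarrow> nat set \<Rightarrow> 's rstruct set" where
  "structures_on ar L D = {A. Dom A = D \<and>
     (\<forall>R. R \<notin> L \<longrightarrow> Rel A R = {}) \<and>
     (\<forall>R\<in>L. \<forall>xs\<in>Rel A R. length xs = ar R \<and> distinct xs \<and> set xs \<subseteq> D)}"

definition induced :: "'s rstruct \<Rightarrow> nat set \<Rightarrow> 's rstruct" where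
  "induced A B = \<lparr>Dom = B, Rel = (\<lambda>R. {xs \<in> Rel A R. set xs \<subseteq> B})\<rparr>"

definition pullback :: "(nat \<Rightarrow> nat) \<Rightarrow> nat set \<Rightarrow> 's rstruct \<Rightarrow> 's rstruct" where
  "pullback \<phi> D A = \<lparr>Dom = D, Rel = (\<lambda>R. {xs. set xs \<subseteq> D \<and> map \<phi> xs \<in> Rel A R})\<rparr>"

definition injective_hom :: "(nat \<Rightarrow> nat) \<Rightarrow> 's rstruct \<Rightarrow> 's rstruct \<Rightarrow> bool" where
  "injective_hom f A B \<longleftrightarrow> inj_on f (Dom A) \<and> f ` Dom A \<subseteq> Dom B \<and>
     (\<forall>R. \<forall>xs\<in>Rel A R. map f xs \<in> Rel B R)"

definition embedding :: "(nat \<Rightarrow> nat) \<Rightarrow> 's rstruct \<Rightarrow> 's rstruct \<Rightarrow> bool" where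
  "embedding f A B \<longleftrightarrow> inj_on f (Dom A) \<and> f ` Dom A \<subseteq> Dom B \<and>
     (\<forall>R xs. set xs \<subseteq> Dom A \<longrightarrow> (xs \<in> Rel A R \<longleftrightarrow> map f xs \<in> Rel B R))"

definition isomorphic :: "'s rstruct \<Rightarrow> 's rstruct \<Rightarrow> bool" where
  "isomorphic A B \<longleftrightarrow> (\<exists>f. embedding f A B \<and> f ` Dom A = Dom B)"

definition hereditary_class :: "('s \<Rightarrow> nat) \<Rightarrow> 's set \<Rightarrow> 's rstruct set \<Rightarrow> bool" where
  "hereditary_class ar L \<C> \<longleftrightarrow>
     (\<forall>A\<in>\<C>. finite (Dom A) \<and> A \<in> structures_on ar L (Dom A)) \<and>
     (\<forall>A\<in>\<C>. \<forall>D. \<forall>B\<in>structures_on ar L D. isomorphic A B \<longrightarrow> B \<in> \<C>) \<and>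
     (\<forall>A\<in>\<C>. \<forall>B. B \<subseteq> Dom A \<longrightarrow> induced A B \<in> \<C>)"

definition members_on :: "'s rstruct set \<Rightarrow> nat \<Rightarrow> 's rstruct set" where
  "members_on \<C> n = {A \<in> \<C>. Dom A = {1..n}}"

definition uniform_hypergraph :: "nat \<Rightarrow> nat set \<Rightarrow> nat set set \<Rightarrow> bool" where
  "uniform_hypergraph r V E \<longleftrightarrow> finite V \<and> (\<forall>e\<in>E. e \<subseteq> V \<and> card e = r)"

definition overlap_closed ::
  "('s \<Rightarrow> nat) \<Rightarrow> 's set \<Rightarrow> nat \<Rightarrow> 's rstruct set \<Rightarrow> bool" where
  "overlap_closed ar L k \<C> \<longleftrightarrow>
     (\<forall>R\<in>L. k < ar R) \<and>
     (\<forall>r>k. \<exists>c>0. \<exists>\<alpha>>0. \<forall>N. \<exists>n\<ge>N. \<exists>V E.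
        uniform_hypergraph r V E \<and> card V = n \<and>
        real (card E) \<ge> c * real n powr (real k + \<alpha>) \<and>
        (\<forall>e\<in>E. \<forall>e'\<in>E. e \<noteq> e' \<longrightarrow> card (e \<inter> e') \<le> k) \<and>
        (\<forall>H1\<in>members_on \<C> r. \<forall>H2\<in>members_on \<C> r. \<forall>G0\<in>structures_on ar L V.
           (\<forall>e\<in>E. isomorphic (induced G0 e) H1 \<or> isomorphic (induced G0 e) H2) \<longrightarrow>
           (\<exists>G\<in>\<C>. card (Dom G) = n \<and>
              (\<exists>f. injective_hom f G0 G \<and> (\<forall>e\<in>E. embedding f (induced G0 e) G)))))"

text \<open>
  No finiteness of the language \<open>L'\<close> is assumed, so \<open>P A\<close> is a probability measure on a
  \<open>\<sigma>\<close>-algebra on the \<open>L'\<close>-structures on \<open>Dom A\<close>; of this \<open>\<sigma>\<close>-algebra we only ask that it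
  contains the events whose probability is mentioned. With \<open>\<phi>\<close> the identity these include the
  singletons, so for finite \<open>L'\<close> it is the full power set.
\<close>

definition consistent_random_expansion ::
  "('s \<Rightarrow> nat) \<Rightarrow> 's set \<Rightarrow> 's rstruct set \<Rightarrow> 's rstruct set \<Rightarrow>
     ('s rstruct \<Rightarrow> 's rstruct measure) \<Rightarrow> bool" where
  "consistent_random_expansion ar L' \<C> \<C>' P \<longleftrightarrow>
     (\<forall>A\<in>\<C>. prob_space (P A) \<and> space (P A) = structures_on ar L' (Dom A) \<and>
        (AE A' in P A. A' \<in> \<C>')) \<and>
     (\<forall>H\<in>\<C>. \<forall>G\<in>\<C>. \<forall>\<phi>. embedding \<phi> H G \<longrightarrow>
        (\<forall>H'\<in>structures_on ar L' (Dom H).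
           let X = {G' \<in> space (P G). pullback \<phi> (Dom H) (induced G' (\<phi> ` Dom H)) = H'}
           in X \<in> sets (P G) \<and> measure (P H) {H'} = measure (P G) X))"

text \<open>
  The probability that \<open>P A\<close> assigns to a superposition of \<open>A\<close> with an \<open>L'\<close>-structure \<open>A'\<close> on the
  same domain is by definition the one that it assigns to \<open>A'\<close>.
\<close>

definition exchangeable_expansion ::
  "('s \<Rightarrow> nat) \<Rightarrow> 's set \<Rightarrow> 's rstruct set \<Rightarrow> ('s rstruct \<Rightarrow> 's rstruct measure) \<Rightarrow> bool" where
  "exchangeable_expansion ar L' \<C> P \<longleftrightarrow>
     (\<forall>r. \<forall>H1\<in>members_on \<C> r. \<forall>H2\<in>members_on \<C> r. \<forall>H'\<in>structures_on ar L' {1..r}.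
        measure (P H1) {H'} = measure (P H2) {H'})"

end

theory Submission imports Defs "HOL-Real_Asymp.Real_Asymp" begin

text \<open>
  Suppose that \<open>H'\<close> has different probabilities over \<open>H1\<close> and \<open>H2\<close>. Place a copy of
  \<open>H1\<close> or \<open>H2\<close> on each hyperedge, according to a two-colouring, and extend to \<open>G \<in> \<C>\<close>.
  An \<open>L'\<close>-structure on \<open>G\<close> singles out the set of hyperedges on which it induces \<open>H'\<close>; as
  \<open>L'\<close> has arities at most \<open>k\<close>, only \<open>2 ^ O(n ^ k)\<close> sets of hyperedges can arise, whatever
  the colouring. There are \<open>n ^ (k + \<alpha>)\<close> hyperedges, so some colouring is almost balanced on
  all these sets at once. Averaging the imbalance over \<open>P G\<close> shows that the two probabilities
  are arbitrarily close.
\<close>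

section \<open>Signs of small discrepancy\<close>

text \<open>Adding quadratic upper bounds for \<open>exp y\<close> and \<open>exp (- y)\<close> on
  the unit interval cancels the linear terms. The result turns the potential
  \<open>cosh l ^ card E\<close> into a Gaussian-type bound.\<close>

lemma cosh_le_exp_square:
  fixes x :: real
  assumes "\<bar>x\<bar> \<le> 1"
  shows "cosh x \<le> exp (x\<^sup>2)"
proof -
  have pos: "exp y + exp (- y) \<le> 2 * (1 + y\<^sup>2)" if "0 \<le> y" "y \<le> 1" for y :: real
  proof -
    have "exp y \<le> 1 + y + y\<^sup>2"
      using exp_bound that by simp
    moreover have "exp (- y) \<le> 1 - y + y\<^sup>2"
    proof -
      \<comment> \<open>The product is \<open>1 + y ^ 3\<close>.\<close>
      have "1 \<le> (1 - y + y\<^sup>2) * (1 + y)"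
        using that by (simp add: algebra_simps power2_eq_square)
      also have "\<dots> \<le> (1 - y + y\<^sup>2) * exp y"
        using that by (intro mult_left_mono) auto
      finally show ?thesis
        by (simp add: exp_minus field_simps)
    qed
    ultimately show ?thesis by simp
  qed
  have "exp x + exp (- x) \<le> 2 * (1 + x\<^sup>2)"
    using pos[of x] pos[of "- x"] assms by (cases "0 \<le> x") (auto simp: add.commute)
  then have "cosh x \<le> 1 + x\<^sup>2"
    by (simp add: cosh_def)
  also have "\<dots> \<le> exp (x\<^sup>2)"
    by simp
  finally show ?thesis .
qed

text \<open>
  Derandomised Chernoff bound: the signs are chosen one at a time so as not to increase the
  potential beyond its average.
\<close>

lemma ex_signs_sum_cosh_le:
  fixes l :: real
  assumes "finite E" "finite F"
  shows "\<exists>s :: 'a \<Rightarrow> real. range s \<subseteq> {1, -1} \<and>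
    (\<Sum>S\<in>F. cosh (l * sum s (E \<inter> S))) \<le> card F * cosh l ^ card E"
  using assms(1)
proof (induction E)
  case empty
  show ?case by (auto intro!: exI[of _ "\<lambda>_. 1"])
next
  case (insert e E)
  then obtain s :: "'a \<Rightarrow> real" where s: "range s \<subseteq> {1, -1}"
    and le: "(\<Sum>S\<in>F. cosh (l * sum s (E \<inter> S))) \<le> card F * cosh l ^ card E"
    by blast
  define d where "d c = (\<Sum>S\<in>F. cosh (l * sum (s(e := c)) (insert e E \<inter> S)))" for c
  have sum_upd: "sum (s(e := c)) (insert e E \<inter> S) = (if e \<in> S then c else 0) + sum s (E \<inter> S)"
    for c S
  proof -
    have "sum (s(e := c)) (E \<inter> S) = sum s (E \<inter> S)"
      using insert.hyps by (intro sum.cong) auto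
    then show ?thesis
      using insert.hyps by (auto simp: Int_insert_left)
  qed
  \<comment> \<open>If \<open>e\<close> lies in \<open>S\<close>, the addition formulas give
    equality; otherwise the sum over \<open>S\<close> is unchanged and \<open>cosh l\<close> is at
    least 1. So the better sign for \<open>e\<close> multiplies the potential by at most
    \<open>cosh l\<close>.\<close>
  have "cosh (l * sum (s(e := 1)) (insert e E \<inter> S)) + cosh (l * sum (s(e := -1)) (insert e E \<inter> S))
      \<le> 2 * cosh l * cosh (l * sum s (E \<inter> S))" for S
    unfolding sum_upd
    by (auto simp: ring_distribs cosh_add cosh_diff cosh_real_ge_1)
  then have "d 1 + d (-1) \<le> 2 * cosh l * (\<Sum>S\<in>F. cosh (l * sum s (E \<inter> S)))"
    unfolding d_def sum_distrib_left sum.distrib[symmetric] by (intro sum_mono)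
  also have "\<dots> \<le> 2 * cosh l * (card F * cosh l ^ card E)"
    using le by (intro mult_left_mono) auto
  also have "\<dots> = 2 * (card F * cosh l ^ card (insert e E))"
    using insert.hyps by simp
  finally have "d 1 \<le> card F * cosh l ^ card (insert e E) \<or> d (-1) \<le> card F * cosh l ^ card (insert e E)"
    by linarith
  moreover have "range (s(e := c)) \<subseteq> {1, -1}" if "c = 1 \<or> c = -1" for c
    using s that by auto
  ultimately show ?case
    unfolding d_def by blast
qed

text \<open>Each term is bounded by the whole potential, so a large imbalance on a single set would
  already make the potential too large.\<close>

lemma ex_signs_small_discrepancy:
  fixes \<epsilon> :: real
  assumes "finite E" "finite F" "0 < \<epsilon>" "\<epsilon> \<le> 1"
    and small: "2 * card F < exp (\<epsilon>\<^sup>2 * card E / 4)"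
  shows "\<exists>s :: 'a \<Rightarrow> real. range s \<subseteq> {1, -1} \<and> (\<forall>S\<in>F. \<bar>sum s (E \<inter> S)\<bar> < \<epsilon> * card E)"
proof -
  \<comment> \<open>This \<open>l\<close> maximises \<open>l * \<epsilon> - l\<^sup>2\<close>; the
    maximum \<open>\<epsilon>\<^sup>2 / 4\<close> is the rate in the hypothesis on
    \<open>card F\<close>.\<close>
  define l where "l = \<epsilon> / 2"
  obtain s :: "'a \<Rightarrow> real" where s: "range s \<subseteq> {1, -1}"
    and le: "(\<Sum>S\<in>F. cosh (l * sum s (E \<inter> S))) \<le> card F * cosh l ^ card E"
    using ex_signs_sum_cosh_le[OF assms(1,2)] by blast
  have "\<bar>sum s (E \<inter> S)\<bar> < \<epsilon> * card E" if "S \<in> F" for S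
  proof -
    let ?d = "sum s (E \<inter> S)"
    have "exp (l * \<bar>?d\<bar>) \<le> 2 * cosh (l * ?d)"
      by (cases "0 \<le> ?d") (auto simp: cosh_def)
    also have "cosh (l * ?d) \<le> (\<Sum>S\<in>F. cosh (l * sum s (E \<inter> S)))"
      using assms(2) that by (intro member_le_sum) auto
    also note le
    also have "card F * cosh l ^ card E \<le> card F * exp (l\<^sup>2) ^ card E"
      using assms(3,4) by (intro mult_left_mono power_mono cosh_le_exp_square) (auto simp: l_def)
    also have "exp (l\<^sup>2) ^ card E = exp (\<epsilon>\<^sup>2 * card E / 4)"
      by (simp add: l_def power_divide mult.commute flip: exp_of_nat_mult)
    finally have "exp (l * \<bar>?d\<bar>) \<le> (2 * card F) * exp (\<epsilon>\<^sup>2 * card E / 4)"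
      by simp
    also have "\<dots> < exp (\<epsilon>\<^sup>2 * card E / 4) * exp (\<epsilon>\<^sup>2 * card E / 4)"
      using small by (intro mult_strict_right_mono) auto
    also have "\<dots> = exp (l * (\<epsilon> * card E))"
      by (simp add: l_def power2_eq_square flip: exp_add)
    finally show ?thesis
      using assms(3) by (simp add: l_def)
  qed
  with s show ?thesis by blast
qed

section \<open>Amalgamating copies along a hypergraph\<close>

text \<open>The inverse of a surjective embedding is an embedding. The direction is reversed because
  copies are given by maps into the hyperedge, while overlap closure asks for isomorphisms out of
  the induced substructure.\<close>

lemma isomorphicI_embedding:
  assumes "embedding f A B" "f ` Dom A = Dom B"
  shows "isomorphic B A"
proof -
  let ?g = "inv_into (Dom A) f"
  have fg: "f (?g y) = y" if "y \<in> Dom B" for y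
    using that assms(2) by (simp add: f_inv_into_f)
  have gim: "?g ` Dom B = Dom A"
    using assms inv_into_image_cancel[of f "Dom A" "Dom A"] by (simp add: embedding_def)
  have "xs \<in> Rel B R \<longleftrightarrow> map ?g xs \<in> Rel A R" if "set xs \<subseteq> Dom B" for R xs
  proof -
    have "set (map ?g xs) \<subseteq> Dom A"
      using that gim by auto
    then have "map ?g xs \<in> Rel A R \<longleftrightarrow> map f (map ?g xs) \<in> Rel B R"
      using assms(1) unfolding embedding_def by blast
    also have "map f (map ?g xs) = xs"
      using that fg by (auto intro!: map_idI)
    finally show ?thesis ..
  qed
  moreover have "inj_on ?g (Dom B)"
    using assms(2) by (simp add: inj_on_inv_into)
  ultimately show ?thesis
    using gim unfolding isomorphic_def embedding_def by blast
qed

lemma embedding_comp: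
  assumes "embedding f A B" "embedding g B C"
  shows "embedding (g \<circ> f) A C"
  unfolding embedding_def
proof (intro conjI allI impI)
  show "inj_on (g \<circ> f) (Dom A)"
    using assms comp_inj_on inj_on_subset unfolding embedding_def by metis
  show "(g \<circ> f) ` Dom A \<subseteq> Dom C"
    using assms unfolding embedding_def image_comp[symmetric] by blast
  fix R xs assume "set xs \<subseteq> Dom A"
  moreover from this have "set (map f xs) \<subseteq> Dom B"
    using assms(1) unfolding embedding_def by auto
  ultimately show "xs \<in> Rel A R \<longleftrightarrow> map (g \<circ> f) xs \<in> Rel C R"
    using assms unfolding embedding_def map_map[symmetric] by blast
qed

text \<open>Arities above \<open>k\<close> and overlaps of size at most \<open>k\<close> keep the copies from interfering.\<close>

lemma ex_amalgam_on_hyperedges: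
  fixes H :: "nat set \<Rightarrow> 's rstruct"
  assumes hyp: "uniform_hypergraph r V E"
    and overlap: "\<forall>e\<in>E. \<forall>e'\<in>E. e \<noteq> e' \<longrightarrow> card (e \<inter> e') \<le> k"
    and arity: "\<forall>R\<in>L. k < ar R"
    and H: "\<And>e. e \<in> E \<Longrightarrow> H e \<in> structures_on ar L {1..r}"
    and b: "\<And>e. e \<in> E \<Longrightarrow> bij_betw (b e) {1..r} e"
  obtains G0 where "G0 \<in> structures_on ar L V"
    and "\<And>e. e \<in> E \<Longrightarrow> embedding (b e) (H e) (induced G0 e)"
proof
  \<comment> \<open>Only transported tuples are put in; it remains to exclude that a tuple from
    another hyperedge lands inside \<open>e\<close>.\<close>
  let ?G = "\<lparr>Dom = V, Rel = (\<lambda>R. \<Union>e\<in>E. map (b e) ` Rel (H e) R)\<rparr> :: 's rstruct"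
  have HD: "Dom (H e) = {1..r}"
    and HR: "xs \<in> Rel (H e) R \<Longrightarrow> R \<in> L \<and> length xs = ar R \<and> distinct xs \<and> set xs \<subseteq> {1..r}"
    if "e \<in> E" for e R xs
    using H[OF that] unfolding structures_on_def by blast+
  have EV: "e \<subseteq> V" "finite e" if "e \<in> E" for e
    using hyp that unfolding uniform_hypergraph_def by (auto intro: finite_subset)
  have tuple: "R \<in> L \<and> length ys = ar R \<and> distinct ys \<and> set ys \<subseteq> e"
    if "e \<in> E" "ys \<in> map (b e) ` Rel (H e) R" for e ys R
  proof -
    obtain xs where xs: "ys = map (b e) xs" "xs \<in> Rel (H e) R"
      using \<open>ys \<in> _\<close> by blast
    note * = HR[OF \<open>e \<in> E\<close> xs(2)] and b = b[OF \<open>e \<in> E\<close>]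
    have "inj_on (b e) (set xs)" "b e ` set xs \<subseteq> e"
      using * b unfolding bij_betw_def by (auto intro: inj_on_subset)
    then show ?thesis
      using * xs by (simp add: distinct_map)
  qed
  show "?G \<in> structures_on ar L V"
    unfolding structures_on_def using tuple EV(1) by fastforce
  fix e assume e: "e \<in> E"
  have inj: "inj_on (b e) {1..r}" and im: "b e ` {1..r} = e"
    using b[OF e] by (auto simp: bij_betw_def)
  have "xs \<in> Rel (H e) R \<longleftrightarrow> map (b e) xs \<in> Rel (induced ?G e) R" if xs: "set xs \<subseteq> {1..r}" for R xs
  proof
    assume "xs \<in> Rel (H e) R"
    then show "map (b e) xs \<in> Rel (induced ?G e) R"
      using e xs im by (auto simp: induced_def)
  next
    assume "map (b e) xs \<in> Rel (induced ?G e) R"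
    then obtain e' where e': "e' \<in> E" "map (b e) xs \<in> map (b e') ` Rel (H e') R"
      and sub: "set (map (b e) xs) \<subseteq> e"
      by (auto simp: induced_def)
    note * = tuple[OF e']
    \<comment> \<open>The entries are distinct and lie in both hyperedges, so different hyperedges
      would share more than \<open>k\<close> vertices.\<close>
    have "k < card (set (map (b e) xs))"
      using * arity distinct_card by metis
    also have "\<dots> \<le> card (e \<inter> e')"
      using * sub EV(2)[OF e] by (intro card_mono) auto
    finally have "e = e'"
      using overlap e e'(1) by force
    then obtain xs' where xs': "map (b e) xs = map (b e) xs'" "xs' \<in> Rel (H e) R"
      using e'(2) by blast
    have "set xs' \<subseteq> {1..r}"
      using HR[OF e xs'(2)] by blast
    then have "xs = xs'"
      using xs'(1) xs inj by (auto intro: map_inj_on inj_on_subset)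
    then show "xs \<in> Rel (H e) R"
      using xs' by simp
  qed
  then show "embedding (b e) (H e) (induced ?G e)"
    using inj im unfolding embedding_def HD[OF e] by (simp add: induced_def)
qed

section \<open>Traces of expansions on the hyperedges\<close>

text \<open>Tuples longer than \<open>k\<close> lie in no relation on either side. For finite
  \<open>D\<close> only finitely many tuples remain to be compared, however many symbols
  \<open>L'\<close> has.\<close>

lemma pullback_induced_eq_iff:
  assumes "A \<in> structures_on ar L' D" "B \<in> structures_on ar L' D'"
    and "\<forall>R\<in>L'. ar R \<le> k"
  shows "pullback \<phi> D (induced B (\<phi> ` D)) = A \<longleftrightarrow>
    (\<forall>xs. set xs \<subseteq> D \<and> length xs \<le> k \<longrightarrow> (\<forall>R. xs \<in> Rel A R \<longleftrightarrow> map \<phi> xs \<in> Rel B R))"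
proof -
  have D: "Dom A = D"
    using assms(1) by (auto simp: structures_on_def)
  have A: "length xs \<le> k \<and> set xs \<subseteq> D" if "xs \<in> Rel A R" for R xs
    using assms(1,3) that unfolding structures_on_def by fastforce
  have B: "length xs \<le> k" if "xs \<in> Rel B R" for R xs
    using assms(2,3) that unfolding structures_on_def by fastforce
  have "pullback \<phi> D (induced B (\<phi> ` D)) = A \<longleftrightarrow>
      Rel A = (\<lambda>R. {xs. set xs \<subseteq> D \<and> map \<phi> xs \<in> Rel B R \<and> \<phi> ` set xs \<subseteq> \<phi> ` D})"
    unfolding pullback_def induced_def using D by (cases A) auto
  also have "\<dots> \<longleftrightarrow> (\<forall>R xs. xs \<in> Rel A R \<longleftrightarrow> set xs \<subseteq> D \<and> map \<phi> xs \<in> Rel B R)"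
    by (auto simp: fun_eq_iff set_eq_iff image_mono)
  also have "\<dots> \<longleftrightarrow> (\<forall>xs. set xs \<subseteq> D \<and> length xs \<le> k \<longrightarrow> (\<forall>R. xs \<in> Rel A R \<longleftrightarrow> map \<phi> xs \<in> Rel B R))"
    using A B by (metis length_map)
  finally show ?thesis .
qed

text \<open>
  Counting sets of pairs of tuples instead of structures keeps the bound finite when \<open>L'\<close> is
  infinite.
\<close>

definition tuple_traces ::
  "nat \<Rightarrow> nat set \<Rightarrow> nat set \<Rightarrow> (nat set \<Rightarrow> nat \<Rightarrow> nat) \<Rightarrow> nat set set \<Rightarrow> nat set set set" where
  "tuple_traces k D V b E =
    (\<lambda>M. {e \<in> E. \<forall>xs. set xs \<subseteq> D \<and> length xs \<le> k \<longrightarrow> (xs, map (b e) xs) \<in> M}) `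
      Pow ({xs. set xs \<subseteq> D \<and> length xs \<le> k} \<times> {ys. set ys \<subseteq> V \<and> length ys \<le> k})"

text \<open>\<open>B\<close> and \<open>f\<close> enter only through the choice of a set of pairs.
  Hence a family mentioning neither captures all traces, and it can be fixed before the colouring on
  which \<open>B\<close> and \<open>f\<close> will depend.\<close>

lemma pullback_trace_in_tuple_traces:
  assumes A: "A \<in> structures_on ar L' D" and B: "B \<in> structures_on ar L' D'"
    and arity: "\<forall>R\<in>L'. ar R \<le> k"
    and b: "\<And>e. e \<in> E \<Longrightarrow> b e ` D \<subseteq> V"
  shows "{e \<in> E. pullback (f \<circ> b e) D (induced B ((f \<circ> b e) ` D)) = A} \<in> tuple_traces k D V b E"
proof -
  \<comment> \<open>A pair records agreement for all symbols at once.\<close>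
  let ?M = "{(xs, ys). (set xs \<subseteq> D \<and> length xs \<le> k) \<and> (set ys \<subseteq> V \<and> length ys \<le> k) \<and>
    (\<forall>R. xs \<in> Rel A R \<longleftrightarrow> map f ys \<in> Rel B R)}"
  have "{e \<in> E. pullback (f \<circ> b e) D (induced B ((f \<circ> b e) ` D)) = A} =
      {e \<in> E. \<forall>xs. set xs \<subseteq> D \<and> length xs \<le> k \<longrightarrow> (xs, map (b e) xs) \<in> ?M}"
    unfolding pullback_induced_eq_iff[OF A B arity] using b by fastforce
  moreover have "?M \<in> Pow ({xs. set xs \<subseteq> D \<and> length xs \<le> k} \<times> {ys. set ys \<subseteq> V \<and> length ys \<le> k})"
    by auto
  ultimately show ?thesis
    unfolding tuple_traces_def by blast
qed

lemma card_lists_length_le_bound: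
  assumes "finite A"
  shows "card {xs. set xs \<subseteq> A \<and> length xs \<le> k} \<le> Suc k * Suc (card A) ^ k"
proof -
  have "card {xs. set xs \<subseteq> A \<and> length xs \<le> k} = (\<Sum>i\<le>k. card A ^ i)"
    by (rule card_lists_length_le[OF assms])
  \<comment> \<open>The successor makes the base at least 1, so the exponent can be raised to
    \<open>k\<close> even for empty \<open>A\<close>.\<close>
  also have "\<dots> \<le> (\<Sum>i\<le>k. Suc (card A) ^ k)"
    by (intro sum_mono order_trans[OF power_mono[of "card A" "Suc (card A)"] power_increasing]) auto
  finally show ?thesis by simp
qed

lemma card_tuple_traces_le:
  assumes "finite D" "finite V"
  shows "finite (tuple_traces k D V b E)"
    and "card (tuple_traces k D V b E) \<le> 2 ^ (Suc k * Suc (card D) ^ k * (Suc k * Suc (card V) ^ k))"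
proof -
  let ?l = "\<lambda>D. {xs. set xs \<subseteq> D \<and> length xs \<le> k}"
  have fin: "finite (?l D)" "finite (?l V)"
    using assms by (auto intro: finite_lists_length_le)
  then have finQ: "finite (Pow (?l D \<times> ?l V))" by blast
  then show "finite (tuple_traces k D V b E)"
    unfolding tuple_traces_def by (rule finite_imageI)
  have "card (tuple_traces k D V b E) \<le> card (Pow (?l D \<times> ?l V))"
    unfolding tuple_traces_def by (rule card_image_le[OF finQ])
  also have "\<dots> = 2 ^ (card (?l D) * card (?l V))"
    using fin by (simp add: card_Pow card_cartesian_product)
  also have "\<dots> \<le> 2 ^ (Suc k * Suc (card D) ^ k * (Suc k * Suc (card V) ^ k))"
    using assms by (intro power_increasing mult_mono card_lists_length_le_bound) auto
  finally show "card (tuple_traces k D V b E) \<le> \<dots>" .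
qed

section \<open>Averaging and growth estimates\<close>

text \<open>By linearity the weighted sum is the expectation of the signed count of the events
  containing the sample point, and a pointwise bound passes to the expectation.\<close>

lemma (in prob_space) abs_sum_prob_le:
  fixes s :: "'e \<Rightarrow> real"
  assumes "finite E" and X: "\<And>e. e \<in> E \<Longrightarrow> X e \<in> events"
    and le: "\<And>x. x \<in> space M \<Longrightarrow> \<bar>sum s (E \<inter> {e. x \<in> X e})\<bar> \<le> B"
  shows "\<bar>\<Sum>e\<in>E. s e * prob (X e)\<bar> \<le> B"
proof -
  let ?g = "\<lambda>x. \<Sum>e\<in>E. s e * indicator (X e) x"
  have int: "integrable M (\<lambda>x. s e * indicator (X e) x)" if "e \<in> E" for e
    using X[OF that] by (auto intro!: integrable_mult_right integrable_real_indicator simp: emeasure_eq_measure)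
  then have "(\<Sum>e\<in>E. s e * prob (X e)) = expectation ?g"
    using X by (subst Bochner_Integration.integral_sum) auto
  moreover have "\<bar>?g x\<bar> \<le> B" if "x \<in> space M" for x
  proof -
    have "?g x = sum s (E \<inter> {e. x \<in> X e})"
      using assms(1) by (auto simp: sum.inter_restrict indicator_def intro!: sum.cong)
    then show ?thesis
      using le[OF that] by simp
  qed
  moreover have "integrable M ?g"
    using int by (rule Bochner_Integration.integrable_sum)
  ultimately show ?thesis
    by (auto simp: abs_le_iff intro!: integral_le_const)
       (metis (no_types, lifting) AE_I2 integral_ge_const minus_le_iff)
qed

lemma eventually_exp_poly_dominates:
  fixes a \<alpha> :: real
  assumes "0 < a" "0 < \<alpha>"
  shows "\<exists>N. \<forall>n\<ge>N. 4 * 2 ^ (K * Suc n ^ k) < exp (a * real n powr (k + \<alpha>))"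
proof -
  have "filterlim (\<lambda>n. real n powr \<alpha>) at_top sequentially"
    using assms(2) by real_asymp
  \<comment> \<open>The summand 2 comes from \<open>4 = 2 ^ 2\<close>, the factor
    \<open>2 ^ k\<close> from \<open>Suc n \<le> 2 * n\<close>; the base 2 is replaced by
    \<open>exp 1\<close>.\<close>
  then have ev: "eventually (\<lambda>n. (K + 2) * 2 ^ k / a < real n powr \<alpha>) sequentially"
    by (simp add: filterlim_at_top_dense)
  have dom: "4 * 2 ^ (K * Suc n ^ k) < exp (a * real n powr (k + \<alpha>))"
    if large: "(K + 2) * 2 ^ k / a < real n powr \<alpha>" and n: "1 \<le> n" for n
  proof -
    have "4 * 2 ^ (K * Suc n ^ k) = (2 :: real) ^ (K * Suc n ^ k + 2)"
      by (simp add: power_add)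
    also have "\<dots> \<le> exp 1 ^ (K * Suc n ^ k + 2)"
      using exp_ge_add_one_self[of 1] by (intro power_mono) auto
    also have "\<dots> = exp (real (K * Suc n ^ k + 2))"
      by (simp only: mult_1_right flip: exp_of_nat_mult)
    also have "real (K * Suc n ^ k + 2) \<le> real ((K + 2) * (2 * n) ^ k)"
    proof -
      have "K * Suc n ^ k + 2 * 1 \<le> K * (2 * n) ^ k + 2 * (2 * n) ^ k"
        using n by (intro add_mono mult_left_mono power_mono) auto
      then show ?thesis
        by (simp only: of_nat_le_iff add_mult_distrib)
    qed
    also have "real ((K + 2) * (2 * n) ^ k) = ((K + 2) * 2 ^ k) * real n powr k"
      using n by (simp add: power_mult_distrib powr_realpow algebra_simps)
    also have "\<dots> < (a * real n powr \<alpha>) * real n powr k"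
      using large n assms(1) by (intro mult_strict_right_mono) (auto simp: field_simps)
    also have "\<dots> = a * real n powr (k + \<alpha>)"
      by (simp add: powr_add)
    finally show ?thesis by simp
  qed
  have "eventually (\<lambda>n. 4 * 2 ^ (K * Suc n ^ k) < exp (a * real n powr (k + \<alpha>))) sequentially"
    by (rule eventually_mono[OF eventually_conj[OF ev eventually_ge_at_top[of 1]]]) (use dom in auto)
  then show ?thesis
    by (simp add: eventually_sequentially)
qed

section \<open>Comparison of the two probabilities\<close>

theorem theorem3p19:
  fixes ar :: "'s \<Rightarrow> nat" and L L' :: "'s set" and k :: nat
    and \<C> \<C>' :: "'s rstruct set" and P :: "'s rstruct \<Rightarrow> 's rstruct measure"
  assumes "2 \<le> k"
    and "L \<inter> L' = {}"
    and "hereditary_class ar L \<C>"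
    and "overlap_closed ar L k \<C>"
    and "hereditary_class ar L' \<C>'"
    and "\<forall>R\<in>L'. ar R \<le> k"
    and "consistent_random_expansion ar L' \<C> \<C>' P"
  shows "exchangeable_expansion ar L' \<C> P"
  unfolding exchangeable_expansion_def
proof (intro allI ballI)
  fix r H1 H2 H'
  assume H: "H1 \<in> members_on \<C> r" "H2 \<in> members_on \<C> r" and H': "H' \<in> structures_on ar L' {1..r}"
  have arity: "\<forall>R\<in>L. k < ar R"
    using assms(4) unfolding overlap_closed_def by blast
  have HC: "H1 \<in> \<C>" "H2 \<in> \<C>" and HD: "Dom H1 = {1..r}" "Dom H2 = {1..r}"
    using H by (auto simp: members_on_def)
  then have Hs: "H1 \<in> structures_on ar L {1..r}" "H2 \<in> structures_on ar L {1..r}"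
    using assms(3) unfolding hereditary_class_def by metis+
  have consistent: "{G' \<in> space (P G). pullback \<phi> (Dom A) (induced G' (\<phi> ` Dom A)) = B} \<in> sets (P G) \<and>
      measure (P A) {B} =
      measure (P G) {G' \<in> space (P G). pullback \<phi> (Dom A) (induced G' (\<phi> ` Dom A)) = B}"
    if "A \<in> \<C>" "G \<in> \<C>" "embedding \<phi> A G" "B \<in> structures_on ar L' (Dom A)" for A G \<phi> B
    using assms(7)[unfolded consistent_random_expansion_def Let_def, THEN conjunct2] that by blast
  define p1 p2 where "p1 = measure (P H1) {H'}" and "p2 = measure (P H2) {H'}"
  show "measure (P H1) {H'} = measure (P H2) {H'}"
  proof (cases "r \<le> k")
    case True
    \<comment> \<open>A tuple in a relation would need more than \<open>k\<close> distinct entries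
      among at most \<open>k\<close> points. So neither structure has any tuples, and the two
      coincide.\<close>
    have "Rel A R = {}" if A: "A \<in> structures_on ar L {1..r}" for A R
    proof (rule ccontr)
      assume "Rel A R \<noteq> {}"
      then obtain xs where xs: "xs \<in> Rel A R" by blast
      with A have "R \<in> L" "length xs = ar R" "distinct xs" "set xs \<subseteq> {1..r}"
        unfolding structures_on_def by blast+
      then have "k < card (set xs)" "card (set xs) \<le> card {1..r}"
        using arity card_mono[of "{1..r}" "set xs"] by (simp_all add: distinct_card)
      with True show False by simp
    qed
    from this[OF Hs(1)] this[OF Hs(2)] HD have "H1 = H2"
      by (intro rstruct.equality) auto
    then show ?thesis by simp
  next
    case False
    show ?thesis
    proof (rule ccontr)
      assume "measure (P H1) {H'} \<noteq> measure (P H2) {H'}"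
      \<comment> \<open>The averaging will give
        \<open>\<bar>p1 - p2\<bar> / 2 \<le> 2 * \<epsilon>\<close>; the divisor 8 makes the right
        side half of the left.\<close>
      define \<epsilon> where "\<epsilon> = \<bar>p1 - p2\<bar> / 8"
      have prob: "prob_space (P A)" if "A \<in> \<C>" for A
        using assms(7) that unfolding consistent_random_expansion_def by blast
      have p: "0 \<le> p1" "p1 \<le> 1" "0 \<le> p2" "p2 \<le> 1"
        using HC by (auto simp: p1_def p2_def intro: prob_space.prob_le_1 prob)
      have \<epsilon>: "0 < \<epsilon>" "\<epsilon> \<le> 1"
        using \<open>_ \<noteq> _\<close> p unfolding \<epsilon>_def p1_def[symmetric] p2_def[symmetric] by auto
      obtain c \<alpha> :: real where c: "0 < c" "0 < \<alpha>" and hyp: "\<forall>N. \<exists>n\<ge>N. \<exists>V E.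
          uniform_hypergraph r V E \<and> card V = n \<and>
          real (card E) \<ge> c * real n powr (real k + \<alpha>) \<and>
          (\<forall>e\<in>E. \<forall>e'\<in>E. e \<noteq> e' \<longrightarrow> card (e \<inter> e') \<le> k) \<and>
          (\<forall>H1\<in>members_on \<C> r. \<forall>H2\<in>members_on \<C> r. \<forall>G0\<in>structures_on ar L V.
             (\<forall>e\<in>E. isomorphic (induced G0 e) H1 \<or> isomorphic (induced G0 e) H2) \<longrightarrow>
             (\<exists>G\<in>\<C>. card (Dom G) = n \<and>
                (\<exists>f. injective_hom f G0 G \<and> (\<forall>e\<in>E. embedding f (induced G0 e) G))))"
        using assms(4)[unfolded overlap_closed_def, THEN conjunct2, THEN spec, of r, THEN mp,
            OF False[unfolded not_le]]
        by (elim exE conjE) (rule that)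
      \<comment> \<open>\<open>K\<close> collects the factors of the trace bound that do not depend
        on \<open>n\<close>.\<close>
      define K where "K = Suc k * Suc r ^ k * Suc k"
      have "0 < \<epsilon>\<^sup>2 * c / 4"
        using c \<epsilon> by simp
      then obtain N where N: "4 * 2 ^ (K * Suc n ^ k) < exp (\<epsilon>\<^sup>2 * c / 4 * real n powr (k + \<alpha>))"
        if "N \<le> n" for n
        using eventually_exp_poly_dominates[OF _ c(2)] by meson
      \<comment> \<open>\<open>Suc N\<close> makes \<open>n\<close> positive, so \<open>E\<close> is
        nonempty and \<open>card E\<close> can be cancelled at the end.\<close>
      obtain n V E where "Suc N \<le> n" and uni: "uniform_hypergraph r V E" and V: "card V = n"
        and E: "c * real n powr (real k + \<alpha>) \<le> card E"
        and overlap: "\<forall>e\<in>E. \<forall>e'\<in>E. e \<noteq> e' \<longrightarrow> card (e \<inter> e') \<le> k"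
        and amalgam: "\<And>G0. G0 \<in> structures_on ar L V \<Longrightarrow>
          \<forall>e\<in>E. isomorphic (induced G0 e) H1 \<or> isomorphic (induced G0 e) H2 \<Longrightarrow>
          \<exists>G\<in>\<C>. \<exists>f. \<forall>e\<in>E. embedding f (induced G0 e) G"
        using hyp[THEN spec, of "Suc N"] H by metis
      have finV: "finite V" and EV: "\<And>e. e \<in> E \<Longrightarrow> e \<subseteq> V \<and> card e = r"
        using uni unfolding uniform_hypergraph_def by blast+
      have finE: "finite E"
        using EV finV by (intro finite_subset[of E "Pow V"]) auto
      have "0 < c * real n powr (real k + \<alpha>)"
        using c \<open>Suc N \<le> n\<close> by simp
      with E have E0: "0 < real (card E)" by linarith
      have "\<exists>h. bij_betw h {1..r} e" if "e \<in> E" for e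
        using EV[OF that] finV finite_subset ex_bij_betw_nat_finite_1 by metis
      then obtain b where b: "\<And>e. e \<in> E \<Longrightarrow> bij_betw (b e) {1..r} e"
        by metis
      \<comment> \<open>Besides the traces, \<open>E\<close> itself is included, so that both
        colours occur about equally often. The family is fixed before the signs are chosen.\<close>
      define F where "F = insert E (tuple_traces k {1..r} V b E)"
      note traces = card_tuple_traces_le[OF _ finV, of "{1..r}" k b E, unfolded V]
      have "card F \<le> Suc (2 ^ (K * Suc n ^ k))"
        using traces by (auto simp: F_def K_def card_insert_if mult.assoc simp del: mult_Suc mult_Suc_right)
      moreover have "1 \<le> (2 :: nat) ^ (K * Suc n ^ k)"
        by simp
      ultimately have "2 * card F \<le> 4 * 2 ^ (K * Suc n ^ k)"
        by linarith
      then have "real (2 * card F) \<le> real (4 * 2 ^ (K * Suc n ^ k))"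
        by (simp only: of_nat_le_iff)
      also have "\<dots> < exp (\<epsilon>\<^sup>2 * c / 4 * real n powr (k + \<alpha>))"
        using N[of n] \<open>Suc N \<le> n\<close> by simp
      also have "\<dots> = exp (\<epsilon>\<^sup>2 * (c * real n powr (real k + \<alpha>)) / 4)"
        by simp
      also have "\<dots> \<le> exp (\<epsilon>\<^sup>2 * card E / 4)"
        using E by (simp add: mult_left_mono)
      finally have small: "2 * card F < exp (\<epsilon>\<^sup>2 * card E / 4)" by simp
      have "finite F"
        using traces by (simp add: F_def)
      from ex_signs_small_discrepancy[OF finE this \<epsilon> small] obtain s :: "nat set \<Rightarrow> real" where s: "range s \<subseteq> {1, -1}"
        and disc: "\<And>S. S \<in> F \<Longrightarrow> \<bar>sum s (E \<inter> S)\<bar> < \<epsilon> * card E"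
        by (elim exE conjE) (use that in simp)
      define h where "h e = (if s e = 1 then H1 else H2)" for e
      have hs: "h e \<in> structures_on ar L {1..r}" for e
        using Hs by (simp add: h_def)
      obtain G0 where G0: "G0 \<in> structures_on ar L V"
        and emb: "\<And>e. e \<in> E \<Longrightarrow> embedding (b e) (h e) (induced G0 e)"
        by (rule ex_amalgam_on_hyperedges[OF uni overlap arity, where H = h and b = b])
          (use hs b in blast)+
      have hD: "Dom (h e) = {1..r}" and hC: "h e \<in> \<C>" for e
        using HD HC by (auto simp: h_def)
      have "isomorphic (induced G0 e) (h e)" if "e \<in> E" for e
        using emb[OF that] b[OF that] hD
        by (intro isomorphicI_embedding[of "b e"]) (auto simp: induced_def bij_betw_def)
      then have "\<forall>e\<in>E. isomorphic (induced G0 e) H1 \<or> isomorphic (induced G0 e) H2"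
        unfolding h_def by (metis (full_types))
      from amalgam[OF G0 this] obtain G f where G: "G \<in> \<C>"
        and f: "\<And>e. e \<in> E \<Longrightarrow> embedding f (induced G0 e) G"
        by blast
      \<comment> \<open>\<open>X e\<close> is the event that the copy on \<open>e\<close> carries
        \<open>H'\<close>. By consistency its probability is \<open>p1\<close> or \<open>p2\<close>
        according to the colour of \<open>e\<close>.\<close>
      define X where "X e = {G' \<in> space (P G).
        pullback (f \<circ> b e) {1..r} (induced G' ((f \<circ> b e) ` {1..r})) = H'}" for e
      have X: "X e \<in> sets (P G) \<and> measure (P (h e)) {H'} = measure (P G) (X e)" if "e \<in> E" for e
      proof -
        have "embedding (f \<circ> b e) (h e) G"
          using embedding_comp[OF emb f] that by blast
        from consistent[OF hC G this, unfolded hD, OF H'] show ?thesis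
          by (simp only: X_def)
      qed
      \<comment> \<open>\<open>G\<close> and \<open>f\<close> depend on the signs, yet the
        hyperedges on which \<open>G'\<close> induces \<open>H'\<close> form one of the traces in
        \<open>F\<close>, so the discrepancy bound holds at every sample point.\<close>
      have "\<bar>sum s (E \<inter> {e. G' \<in> X e})\<bar> \<le> \<epsilon> * card E" if G': "G' \<in> space (P G)" for G'
      proof -
        have "G' \<in> structures_on ar L' (Dom G)"
          using G' G assms(7) unfolding consistent_random_expansion_def by blast
        moreover have "b e ` {1..r} \<subseteq> V" if "e \<in> E" for e
          using b[OF that] EV[OF that] by (simp add: bij_betw_def)
        ultimately have "{e \<in> E. G' \<in> X e} \<in> F"
          using pullback_trace_in_tuple_traces[OF H' _ assms(6), of G' "Dom G" E b V f] G'
          by (simp add: F_def X_def)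
        from disc[OF this] show ?thesis
          by (simp add: Int_def)
      qed
      then have "\<bar>\<Sum>e\<in>E. s e * measure (P G) (X e)\<bar> \<le> \<epsilon> * card E"
        using X by (intro prob_space.abs_sum_prob_le[OF prob[OF G] finE]) auto
      \<comment> \<open>A sign 1 contributes \<open>p1\<close> and a sign -1 contributes
        \<open>- p2\<close>. The affine form in \<open>s e\<close> separates the gap
        \<open>p1 - p2\<close> from the colour bias \<open>sum s E\<close>.\<close>
      also have "(\<Sum>e\<in>E. s e * measure (P G) (X e)) = (\<Sum>e\<in>E. (p1 - p2) / 2 + (p1 + p2) / 2 * s e)"
      proof (rule sum.cong)
        fix e assume "e \<in> E"
        moreover have "s e = 1 \<or> s e = -1"
          using s by blast
        ultimately show "s e * measure (P G) (X e) = (p1 - p2) / 2 + (p1 + p2) / 2 * s e"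
          using X[of e] by (auto simp: h_def p1_def p2_def field_simps)
      qed simp
      also have "\<dots> = (p1 - p2) / 2 * card E + (p1 + p2) / 2 * sum s E"
        by (simp add: sum.distrib sum_distrib_left)
      finally have main: "\<bar>(p1 - p2) / 2 * card E + (p1 + p2) / 2 * sum s E\<bar> \<le> \<epsilon> * card E" .
      have "\<bar>(p1 + p2) / 2 * sum s E\<bar> \<le> 1 * (\<epsilon> * card E)"
        unfolding abs_mult using disc[of E] p by (intro mult_mono) (auto simp: F_def)
      with main have "\<bar>(p1 - p2) / 2 * card E\<bar> \<le> 2 * \<epsilon> * card E"
        by linarith
      then have "\<bar>p1 - p2\<bar> / 2 * card E \<le> 2 * \<epsilon> * card E"
        by (simp add: abs_mult)
      then have "\<bar>p1 - p2\<bar> / 2 \<le> 2 * \<epsilon>"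
        using E0 by (simp only: mult_le_cancel_right_pos)
      then show False
        using \<epsilon> by (simp add: \<epsilon>_def)
    qed
  qed
qed

end
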